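(* Let $\phi:\mathbb{R}\to\mathbb{R}_+$ be a radially decreasing, weakly singular interaction protocol satisfying, for some $s\in(0,1)$ and constants $\Lambda>0$, $R_0>0$, $$\phi(x)\le\Lambda|x|^{-s},\qquad |x|<R_0 .$$ Let $X(\cdot,t)$, $t\ge0$, be the Lagrangian flow of the one-dimensional Euler Alignment model (with $\kappa=1$) on the bounded open set $\Omega\subset\mathbb{R}$, with mass measure $m$ of total mass $M_0$ and associated function $\psi_0$, as defined in the context. Let $\alpha,\beta\in\Omega$ with $\alpha<\beta$, and write $X_{\beta\alpha}(t)=X(\beta,t)-X(\alpha,t)$ and $\psi_{\beta\alpha}=\psi_0(\beta)-\psi_0(\alpha)$. Then whenever $0<X_{\beta\alpha}<2R_0$ we have $$\dot X_{\beta\alpha}\ge\psi_{\beta\alpha}-\frac{2^s\Lambda M_0}{1-s}X_{\beta\alpha}^{1-s}.$$ Consequently, $$\inf_{t\ge0}X_{\beta\alpha}(t)\ge\min\left\{\beta-\alpha,\ \left(\frac{(1-s)\psi_{\beta\alpha}}{2^s\Lambda M_0}\right)^{\frac1{1-s}},\ 2R_0\right\},$$ and $$\liminf_{t\to+\infty}X_{\beta\alpha}(t)\ge\min\left\{\left(\frac{(1-s)\psi_{\beta\alpha}}{2^s\Lambda M_0}\right)^{\frac1{1-s}},\ 2R_0\right\};$$ if $\beta-\alpha$ is less than the value on the right side of the last inequality, then $X_{\beta\alpha}$ increases monotonically at least until it reaches this value.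
   Context: Radially decreasing means that $\phi(x)$ depends only on $|x|$ and is nonincreasing in $|x|$. Weakly singular means that $\phi$ is locally integrable with a singularity at the origin like $|x|^{-s}$ for some $s\in(0,1)$. Setting (1D Euler Alignment in Lagrangian variables, $\kappa=1$): $\Omega=\{\rho_0>0\}\subset\mathbb{R}$ is bounded and open, $u_0:\Omega\to\mathbb{R}$ is the initial velocity, $dm_\gamma=\rho_0(\gamma)\,d\gamma$ is the initial mass measure, with finite total mass $M_0=m(\Omega)$. With $\varphi(x)=\int_0^x\phi(y)\,dy$, put $\psi_0(\alpha)=u_0(\alpha)+\int_\Omega\varphi(\alpha-\gamma)\,dm_\gamma$ for $\alpha\in\Omega$. The Lagrangian flow $X$ satisfies $$\dot X(\alpha,t)=\psi_0(\alpha)-\int_\Omega\varphi(X(\alpha,t)-X(\gamma,t))\,dm_\gamma,\qquad X(\alpha,0)=\alpha,\qquad \alpha\in\Omega,$$ which is the integrated form of the system $\dot X(\alpha,t)=V(\alpha,t)$, $\dot V(\alpha,t)=\int_\Omega\phi(X(\alpha,t)-X(\gamma,t))(V(\gamma,t)-V(\alpha,t))\,dm_\gamma$, $X(\alpha,0)=\alpha$, $V(\alpha,0)=u_0(\alpha)$. The flow is considered for $t\ge0$.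
   Formalization: The inf, liminf and monotonicity claims are stated only for ψ_{βα} ≥ 0, because the power with exponent 1/(1-s) is undefined for ψ_{βα} < 0; monotonicity of φ in |x| and the bound φ ≤ Λ|x|^{-s} are required only for x ≠ 0, as a singular φ has no finite value at 0. *)

theory Defs
  imports "HOL-Analysis.Analysis" "HOL-Library.Landau_Symbols"
begin

text \<open>A real-valued protocol with a singularity at the origin has no meaningful value at \<open>0\<close>, and
  demanding \<open>\<phi> x \<le> \<phi> 0\<close> would contradict the blow-up.  Monotonicity in \<open>\<bar>x\<bar>\<close> is therefore
  required away from the origin only; \<open>\<phi> 0\<close> is an irrelevant value on a null set.\<close>

definition radially_decreasing :: "(real \<Rightarrow> real) \<Rightarrow> bool" where
  "radially_decreasing \<phi> \<longleftrightarrow>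
     (\<forall>x y. \<bar>x\<bar> = \<bar>y\<bar> \<longrightarrow> \<phi> x = \<phi> y) \<and>
     (\<forall>x y. 0 < \<bar>x\<bar> \<and> \<bar>x\<bar> \<le> \<bar>y\<bar> \<longrightarrow> \<phi> y \<le> \<phi> x)"

definition locally_integrable :: "(real \<Rightarrow> real) \<Rightarrow> bool" where
  "locally_integrable f \<longleftrightarrow> (\<forall>K. compact K \<longrightarrow> set_integrable lborel K f)"

text \<open>``Singular like \<open>\<bar>x\<bar>\<^sup>-\<^sup>s\<close>'' means comparable to \<open>\<bar>x\<bar>\<^sup>-\<^sup>s\<close> from above and below near the origin.\<close>

definition weakly_singular :: "(real \<Rightarrow> real) \<Rightarrow> bool" where
  "weakly_singular \<phi> \<longleftrightarrow>
     locally_integrable \<phi> \<and>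
     (\<exists>s. 0 < s \<and> s < 1 \<and> \<phi> \<in> \<Theta>[at 0](\<lambda>x. \<bar>x\<bar> powr (- s)))"

definition initial_support :: "(real \<Rightarrow> real) \<Rightarrow> real set" where
  "initial_support \<rho>0 = {x. \<rho>0 x > 0}"

definition mass_measure :: "(real \<Rightarrow> real) \<Rightarrow> real measure" where
  "mass_measure \<rho>0 = density lebesgue (\<lambda>x. ennreal (\<rho>0 x))"

definition total_mass :: "(real \<Rightarrow> real) \<Rightarrow> real" where
  "total_mass \<rho>0 = measure (mass_measure \<rho>0) (initial_support \<rho>0)"

text \<open>The interval integral is oriented, so the primitive is odd for even \<open>\<phi>\<close>.\<close>

definition primitive :: "(real \<Rightarrow> real) \<Rightarrow> real \<Rightarrow> real" where
  "primitive \<phi> x = (LBINT y=ereal 0..ereal x. \<phi> y)"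

definition psi0 :: "(real \<Rightarrow> real) \<Rightarrow> (real \<Rightarrow> real) \<Rightarrow> (real \<Rightarrow> real) \<Rightarrow> real \<Rightarrow> real" where
  "psi0 \<phi> \<rho>0 u0 \<alpha> =
     u0 \<alpha> + (LINT \<gamma>:initial_support \<rho>0|mass_measure \<rho>0. primitive \<phi> (\<alpha> - \<gamma>))"

text \<open>\<open>X \<alpha> t\<close> is the position at time \<open>t\<close> of the particle starting at \<open>\<alpha>\<close>; only labels in the
  support of \<open>\<rho>0\<close> and times \<open>t \<ge> 0\<close> matter, so the derivative at \<open>t = 0\<close> is one-sided.  The
  integrability clause says that the integral in the equation exists (the Bochner integral of a
  non-integrable function would silently be \<open>0\<close>).\<close>

definition lagrangian_flow ::
  "(real \<Rightarrow> real) \<Rightarrow> (real \<Rightarrow> real) \<Rightarrow> (real \<Rightarrow> real) \<Rightarrow> (real \<Rightarrow> real \<Rightarrow> real) \<Rightarrow> bool" where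
  "lagrangian_flow \<phi> \<rho>0 u0 X \<longleftrightarrow>
     (\<forall>\<alpha>\<in>initial_support \<rho>0.
        X \<alpha> 0 = \<alpha> \<and>
        (\<forall>t\<ge>0.
           set_integrable (mass_measure \<rho>0) (initial_support \<rho>0)
             (\<lambda>\<gamma>. primitive \<phi> (X \<alpha> t - X \<gamma> t)) \<and>
           (X \<alpha> has_real_derivative
              psi0 \<phi> \<rho>0 u0 \<alpha>
              - (LINT \<gamma>:initial_support \<rho>0|mass_measure \<rho>0. primitive \<phi> (X \<alpha> t - X \<gamma> t)))
             (at t within {0..})))"

end

theory Submission
  imports Defs
begin

text \<open>The velocity difference is \<open>\<psi>\<close> minus the integral over the mass of the integrals of \<open>\<phi>\<close> over
  intervals of length \<open>d = X \<beta> - X \<alpha>\<close>. By rearrangement each of these is at most the integral over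
  \<open>[-d/2, d/2]\<close>, where \<open>\<phi>\<close> is dominated by its power singularity because \<open>d/2 < R0\<close>. The resulting
  lower bound on the velocity is positive below the threshold level; when \<open>d \<le> 0\<close> it is just \<open>\<psi>\<close>, as the
  interaction then only pushes the two particles back. A superlevel set of a scalar function is
  invariant if the derivative is nonnegative below it, and it is reached in finite time if the
  derivative is bounded below by a positive constant there.\<close>

section \<open>Scalar differential inequalities on the half-line\<close>

text \<open>Restricting to \<open>{u..v}\<close> keeps the one-sided derivative at time 0 usable, so
  \<open>u = 0\<close> is allowed. That \<open>z\<close> is interior matters in the lemmas
  below.\<close>

lemma mvt_half_line:
  fixes f f' :: "real \<Rightarrow> real"
  assumes deriv: "\<And>t. 0 \<le> t \<Longrightarrow> (f has_real_derivative f' t) (at t within {0..})"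
    and "0 \<le> u" "u < v"
  obtains z where "u < z" "z < v" "f v - f u = f' z * (v - u)"
proof -
  have "\<exists>z\<in>{u<..<v}. f v - f u = (*) (f' z) (v - u)"
  proof (rule mvt_simple[OF \<open>u < v\<close>, where f = f and f' = "\<lambda>t. (*) (f' t)"])
    fix t assume "u \<le> t" "t \<le> v"
    with \<open>0 \<le> u\<close> have "(f has_real_derivative f' t) (at t within {u..v})"
      by (intro has_field_derivative_subset[OF deriv]) auto
    then show "(f has_derivative (*) (f' t)) (at t within {u..v})"
      by (simp add: has_field_derivative_def)
  qed
  then show ?thesis using that by auto
qed

text \<open>Otherwise compactness gives a last time \<open>u\<close> in \<open>{t0..t1}\<close> with
  \<open>a \<le> f u\<close>. After it \<open>f\<close> is below \<open>a\<close>, so its derivative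
  is nonnegative and the mean value theorem yields \<open>f u \<le> f t1\<close>.\<close>

lemma superlevel_invariant:
  fixes f f' :: "real \<Rightarrow> real"
  assumes deriv: "\<And>t. 0 \<le> t \<Longrightarrow> (f has_real_derivative f' t) (at t within {0..})"
    and nonneg: "\<And>t. 0 \<le> t \<Longrightarrow> f t < a \<Longrightarrow> 0 \<le> f' t"
    and t: "0 \<le> t0" "t0 \<le> t1" "a \<le> f t0"
  shows "a \<le> f t1"
proof (rule ccontr)
  assume "\<not> a \<le> f t1"
  define S where "S = {t \<in> {t0..t1}. a \<le> f t}"
  have "continuous_on {0..} f"
    by (rule DERIV_continuous_on) (use deriv in auto)
  then have cont: "continuous_on {t0..t1} f"
    by (rule continuous_on_subset) (use t in auto)
  have "closed ({t0..t1} \<inter> f -` {a..})"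
    by (intro continuous_closed_preimage[OF cont]) auto
  then have "closed S"
    by (simp add: S_def vimage_def Int_def)
  moreover have "bounded S"
    by (rule bounded_subset[of "{t0..t1}"]) (auto simp: S_def)
  ultimately have "compact S" by (simp add: compact_eq_bounded_closed)
  moreover have "S \<noteq> {}" using t by (auto simp: S_def)
  ultimately obtain u where u: "u \<in> S" "\<And>t. t \<in> S \<Longrightarrow> t \<le> u"
    by (meson compact_attains_sup)
  from u(1) \<open>\<not> a \<le> f t1\<close> have "0 \<le> u" "u < t1"
    using t by (auto simp: S_def less_le)
  then obtain z where z: "u < z" "z < t1" "f t1 - f u = f' z * (t1 - u)"
    using mvt_half_line[OF deriv] by metis
  have "f z < a" using u(2)[of z] z u(1) by (force simp: S_def)
  then have "0 \<le> f' z * (t1 - u)"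
    using nonneg[of z] z \<open>0 \<le> u\<close> by simp
  with z(3) u(1) \<open>\<not> a \<le> f t1\<close> show False by (simp add: S_def)
qed

text \<open>Staying below \<open>a\<close> forever, \<open>f\<close> would grow at rate at least
  \<open>\<delta>\<close> and reach \<open>a\<close> by time \<open>T\<close>. Once reached, the
  level is kept by \<open>superlevel_invariant\<close>.\<close>

lemma eventually_ge_of_derivative_ge:
  fixes f f' :: "real \<Rightarrow> real"
  assumes deriv: "\<And>t. 0 \<le> t \<Longrightarrow> (f has_real_derivative f' t) (at t within {0..})"
    and pos: "\<And>t. 0 \<le> t \<Longrightarrow> f t < a \<Longrightarrow> \<delta> \<le> f' t" and "0 < \<delta>"
  shows "eventually (\<lambda>t. a \<le> f t) at_top"
proof -
  have "\<exists>t0\<ge>0. a \<le> f t0"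
  proof (rule ccontr)
    assume "\<not> ?thesis"
    then have below: "\<And>t. 0 \<le> t \<Longrightarrow> f t < a" by force
    define T where "T = (a - f 0) / \<delta>"
    have "0 < T" using below[of 0] \<open>0 < \<delta>\<close> by (simp add: T_def)
    then obtain z where z: "0 < z" "f T - f 0 = f' z * (T - 0)"
      using mvt_half_line[OF deriv, of 0 T] by auto
    have "\<delta> * T \<le> f' z * T"
      using pos[of z] below[of z] z \<open>0 < T\<close> by (intro mult_right_mono) auto
    moreover have "\<delta> * T = a - f 0" using \<open>0 < \<delta>\<close> by (simp add: T_def)
    ultimately show False using z below[of T] \<open>0 < T\<close> by simp
  qed
  then obtain t0 where t0: "0 \<le> t0" "a \<le> f t0" by blast
  have "a \<le> f t" if "t0 \<le> t" for t
  proof (rule superlevel_invariant[OF deriv _ t0(1) that t0(2)])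
    show "0 \<le> f' t" if "0 \<le> t" "f t < a" for t
      using pos[OF that] \<open>0 < \<delta>\<close> by simp
  qed
  then show ?thesis by (auto simp: eventually_at_top_linorder)
qed

text \<open>The intermediate point lies strictly before \<open>v \<le> T\<close>, so positivity for
  \<open>t < T\<close> gives strict growth up to and including \<open>T\<close>.\<close>

lemma strict_mono_on_of_derivative_pos:
  fixes f f' :: "real \<Rightarrow> real"
  assumes deriv: "\<And>t. 0 \<le> t \<Longrightarrow> (f has_real_derivative f' t) (at t within {0..})"
    and pos: "\<And>t. 0 \<le> t \<Longrightarrow> t < T \<Longrightarrow> 0 < f' t"
  shows "strict_mono_on {0..T} f"
proof (rule strict_mono_onI)
  fix u v assume uv: "u \<in> {0..T}" "v \<in> {0..T}" "u < v"
  then obtain z where z: "u < z" "z < v" "f v - f u = f' z * (v - u)"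
    using mvt_half_line[OF deriv, of u v] by auto
  with uv pos[of z] have "0 < f' z * (v - u)" by simp
  with z show "f u < f v" by simp
qed

section \<open>Increments of the primitive\<close>

lemma locally_integrable_Icc:
  "locally_integrable f \<Longrightarrow> set_integrable lborel {a..b} f"
  by (simp add: locally_integrable_def)

lemma primitive_diff:
  assumes "locally_integrable f" and "a \<le> b"
  shows "primitive f b - primitive f a = (LINT y:{a..b}|lborel. f y)"
proof -
  have "interval_lebesgue_integrable lborel
      (min (ereal 0) (min (ereal a) (ereal b))) (max (ereal 0) (max (ereal a) (ereal b))) f"
  proof -
    \<comment> \<open>\<open>{l..u}\<close> is the hull of 0, \<open>a\<close> and \<open>b\<close>.
      Integrability there is what additivity of oriented integrals asks for, wherever 0
      lies.\<close>
    define l u where "l = min 0 (min a b)" and "u = max 0 (max a b)"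
    have "set_integrable lborel {l..u} f" using assms(1) by (rule locally_integrable_Icc)
    then have "set_integrable lborel (einterval (ereal l) (ereal u)) f"
      by (rule set_integrable_subset) (auto simp: einterval_def)
    moreover have "l \<le> u" by (simp add: l_def u_def)
    ultimately have "interval_lebesgue_integrable lborel (ereal l) (ereal u) f"
      by (simp add: interval_lebesgue_integrable_def)
    moreover have "ereal l = min (ereal 0) (min (ereal a) (ereal b))"
      and "ereal u = max (ereal 0) (max (ereal a) (ereal b))"
      by (auto simp: l_def u_def min_def max_def)
    ultimately show ?thesis by simp
  qed
  then have "primitive f a + (LBINT y=ereal a..ereal b. f y) = primitive f b"
    unfolding primitive_def by (rule interval_integral_sum)
  moreover have "(LBINT y=ereal a..ereal b. f y) = (LINT y:{a..b}|lborel. f y)"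
    using assms(2) by (rule interval_integral_Icc)
  ultimately show ?thesis by simp
qed

lemma primitive_mono:
  assumes "locally_integrable f" "\<And>x. 0 \<le> f x" "a \<le> b"
  shows "primitive f a \<le> primitive f b"
proof -
  have "0 \<le> (LINT y:{a..b}|lborel. f y)"
    unfolding set_lebesgue_integral_def using assms(2) by (intro integral_nonneg_AE) simp
  with primitive_diff[OF assms(1,3)] show ?thesis by simp
qed

text \<open>Bathtub principle: with \<open>A\<close> the given and \<open>B\<close> the centred interval,
  \<open>(1\<^sub>A - 1\<^sub>B) (f - f r) \<le> 0\<close> away from the origin, and \<open>1\<^sub>A - 1\<^sub>B\<close> has integral \<open>0\<close>.\<close>

lemma radially_decreasing_integral_le_centred:
  assumes int: "locally_integrable f" and rad: "radially_decreasing f" and "0 < r"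
  shows "(LINT y:{p..p + 2 * r}|lborel. f y) \<le> (LINT y:{-r..r}|lborel. f y)"
proof -
  let ?A = "{p..p + 2 * r}" and ?B = "{-r..r}"
  have const: "set_integrable lborel {a..b} (\<lambda>_. f r)" for a b :: real
    by (rule borel_integrable_atLeastAtMost') simp
  have iA: "set_integrable lborel ?A (\<lambda>y. f y - f r)"
    and iB: "set_integrable lborel ?B (\<lambda>y. f y - f r)"
    by (intro set_integral_diff locally_integrable_Icc[OF int] const)+
  have eq: "(LINT y:{a..a + 2 * r}|lborel. f y - f r) = (LINT y:{a..a + 2 * r}|lborel. f y) - 2 * r * f r" for a
  proof -
    have "(LINT y:{a..a + 2 * r}|lborel. f y - f r)
        = (LINT y:{a..a + 2 * r}|lborel. f y) - (LINT y:{a..a + 2 * r}|lborel. f r)"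
      by (intro set_integral_diff locally_integrable_Icc[OF int] const)
    also have "(LINT y:{a..a + 2 * r}|lborel. f r) = 2 * r * f r"
      using \<open>0 < r\<close> by (simp add: set_lebesgue_integral_def)
    finally show ?thesis .
  qed
  have dec: "f y \<le> f x" if "0 < \<bar>x\<bar>" "\<bar>x\<bar> \<le> \<bar>y\<bar>" for x y
    using rad that unfolding radially_decreasing_def by blast
  have "(LINT y:?A|lborel. f y - f r) \<le> (LINT y:?B|lborel. f y - f r)"
    unfolding set_lebesgue_integral_def
  proof (rule integral_mono_AE)
    show "AE y in lborel. indicat_real ?A y *\<^sub>R (f y - f r) \<le> indicat_real ?B y *\<^sub>R (f y - f r)"
    proof (rule AE_mp[OF AE_lborel_singleton[of 0]], rule AE_I2, rule impI)
      fix y :: real assume "y \<noteq> 0"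
      have "f y \<le> f r" if "y \<notin> ?B"
        using that \<open>0 < r\<close> by (intro dec) auto
      moreover have "f r \<le> f y" if "y \<in> ?B"
        using that \<open>0 < r\<close> \<open>y \<noteq> 0\<close> by (intro dec) auto
      ultimately show "indicat_real ?A y *\<^sub>R (f y - f r) \<le> indicat_real ?B y *\<^sub>R (f y - f r)"
        by (auto simp: indicator_def)
    qed
  qed (use iA iB in \<open>simp_all add: set_integrable_def\<close>)
  then show ?thesis using eq[of p] eq[of "-r"] by simp
qed

lemma integral_le_power_singularity:
  assumes int: "locally_integrable f" and s: "s < 1" and r: "0 \<le> r" "r < R0"
    and bound: "\<forall>x. 0 < \<bar>x\<bar> \<and> \<bar>x\<bar> < R0 \<longrightarrow> f x \<le> \<Lambda> * \<bar>x\<bar> powr (- s)"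
  shows "(LINT y:{-r..r}|lborel. f y) \<le> 2 * \<Lambda> * r powr (1 - s) / (1 - s)"
proof -
  let ?I = "r powr (1 - s) / (1 - s)" and ?g = "\<lambda>y. \<Lambda> * \<bar>y\<bar> powr (- s)"
  have "((\<lambda>y. y powr (- s)) has_integral ?I) {0..r}"
    using has_integral_powr_from_0[of "-s" r] s r by (simp add: add.commute)
  then have pos: "((\<lambda>y. \<bar>y\<bar> powr (- s)) has_integral ?I) {0..r}"
    by (rule has_integral_eq[rotated]) auto
  then have neg: "((\<lambda>y. \<bar>y\<bar> powr (- s)) has_integral ?I) {-r..0}"
    using has_integral_reflect_real[where a = 0 and b = r and f = "\<lambda>y. \<bar>y\<bar> powr (- s)" and i = ?I] by simp
  have "((\<lambda>y. \<bar>y\<bar> powr (- s)) has_integral ?I + ?I) {-r..r}"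
    using has_integral_combine[OF _ _ neg pos] r by simp
  then have g: "(?g has_integral \<Lambda> * (?I + ?I)) {-r..r}"
    by (rule has_integral_mult_right)
  have f: "(f has_integral (LINT y:{-r..r}|lborel. f y)) {-r..r}"
    using set_borel_integral_eq_integral[OF locally_integrable_Icc[OF int]]
    by (simp add: has_integral_integral)
  have "(LINT y:{-r..r}|lborel. f y) \<le> \<Lambda> * (?I + ?I)"
  proof (rule has_integral_le)
    \<comment> \<open>The bound is silent at 0, where the \<open>powr\<close> term is 0 by
      convention and \<open>f 0\<close> may be positive. Replacing this one value by 0 makes the
      comparison pointwise and preserves the integral.\<close>
    show "((\<lambda>y. if y = 0 then 0 else f y) has_integral (LINT y:{-r..r}|lborel. f y)) {-r..r}"
      by (rule has_integral_spike_finite[OF _ _ f, of "{0}"]) auto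
    show "(if y = 0 then 0 else f y) \<le> ?g y" if "y \<in> {-r..r}" for y
      using that bound r by (auto simp: abs_if)
  qed (rule g)
  then show ?thesis by (simp add: field_simps)
qed

text \<open>The centred interval reaches only half the length from the origin, so
  \<open>b - a < 2 * R0\<close> keeps it within the range of the power bound. The factor
  \<open>2 powr s\<close> is 2, for the two halves, times \<open>(1/2) powr (1 - s)\<close>.\<close>

lemma primitive_increment_le:
  assumes int: "locally_integrable f" and rad: "radially_decreasing f" and s: "s < 1"
    and bound: "\<forall>x. 0 < \<bar>x\<bar> \<and> \<bar>x\<bar> < R0 \<longrightarrow> f x \<le> \<Lambda> * \<bar>x\<bar> powr (- s)"
    and d: "0 < b - a" "b - a < 2 * R0"
  shows "primitive f b - primitive f a \<le> 2 powr s * \<Lambda> / (1 - s) * (b - a) powr (1 - s)"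
proof -
  let ?r = "(b - a) / 2"
  have "primitive f b - primitive f a = (LINT y:{a..a + 2 * ?r}|lborel. f y)"
    using primitive_diff[OF int, of a b] d by (simp add: diff_divide_distrib)
  also have "\<dots> \<le> (LINT y:{-?r..?r}|lborel. f y)"
    using d by (intro radially_decreasing_integral_le_centred[OF int rad]) simp
  also have "\<dots> \<le> 2 * \<Lambda> * ?r powr (1 - s) / (1 - s)"
    using d by (intro integral_le_power_singularity[OF int s _ _ bound]) simp_all
  also have "?r powr (1 - s) = (b - a) powr (1 - s) * (2 powr s / 2)"
    using d by (simp add: powr_divide powr_diff)
  finally show ?thesis by (simp add: mult_ac)
qed

section \<open>The mass measure and the relative velocity\<close>

lemma emeasure_mass_measure_finite:
  assumes "integrable lebesgue \<rho>0" and "\<And>x. 0 \<le> \<rho>0 x" and "S \<in> sets lebesgue"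
  shows "emeasure (mass_measure \<rho>0) S < \<infinity>"
proof -
  have "emeasure (mass_measure \<rho>0) S = (\<integral>\<^sup>+x. ennreal (\<rho>0 x) * indicator S x \<partial>lebesgue)"
    unfolding mass_measure_def using assms by (intro emeasure_density) auto
  also have "\<dots> \<le> (\<integral>\<^sup>+x. ennreal (\<rho>0 x) \<partial>lebesgue)"
    by (intro nn_integral_mono) (auto simp: indicator_def)
  also have "\<dots> < \<infinity>"
    using assms by (simp add: nn_integral_eq_integral)
  finally show ?thesis .
qed

text \<open>Openness makes the support measurable and finite mass makes the constant
  \<open>C\<close> integrable over it, so the pointwise bound can be integrated.\<close>

lemma mass_integral_between:
  assumes \<rho>0: "integrable lebesgue \<rho>0" "\<And>x. 0 \<le> \<rho>0 x" and S: "open (initial_support \<rho>0)"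
    and g: "set_integrable (mass_measure \<rho>0) (initial_support \<rho>0) g"
      "set_integrable (mass_measure \<rho>0) (initial_support \<rho>0) h"
    and le: "\<And>x. h x - g x \<le> C"
  shows "(LINT x:initial_support \<rho>0|mass_measure \<rho>0. h x)
       - (LINT x:initial_support \<rho>0|mass_measure \<rho>0. g x) \<le> C * total_mass \<rho>0"
proof -
  let ?M = "mass_measure \<rho>0" and ?S = "initial_support \<rho>0"
  have SM: "?S \<in> sets ?M" and SL: "?S \<in> sets lebesgue"
    using S by (auto simp: mass_measure_def)
  have fin: "emeasure ?M ?S < \<infinity>"
    using \<rho>0 SL by (rule emeasure_mass_measure_finite)
  have C: "set_integrable ?M ?S (\<lambda>_. C)"
    unfolding set_integrable_def using SM fin by simp
  have "(LINT x:?S|?M. h x) - (LINT x:?S|?M. g x) = (LINT x:?S|?M. h x - g x)"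
    using set_integral_diff[OF g(2,1)] by simp
  also have "\<dots> \<le> (LINT x:?S|?M. C)"
    by (intro set_integral_mono C le set_integral_diff g)
  also have "\<dots> = C * total_mass \<rho>0"
    using SM fin by (simp add: set_lebesgue_integral_def total_mass_def)
  finally show ?thesis .
qed

text \<open>Subtracting the velocities leaves \<open>\<psi>\<close> minus the mass integral of the
  increments of \<open>primitive \<phi>\<close> from \<open>X \<alpha> t - X \<gamma> t\<close> to
  \<open>X \<beta> t - X \<gamma> t\<close>. In reversed order these are nonpositive by
  monotonicity; otherwise \<open>primitive_increment_le\<close> bounds them uniformly in
  \<open>\<gamma>\<close>.\<close>

lemma relative_velocity_ge:
  fixes \<phi> \<rho>0 u0 X \<alpha> \<beta>
  defines "v \<equiv> \<lambda>a t. psi0 \<phi> \<rho>0 u0 a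
      - (LINT \<gamma>:initial_support \<rho>0|mass_measure \<rho>0. primitive \<phi> (X a t - X \<gamma> t))"
    and "\<psi> \<equiv> psi0 \<phi> \<rho>0 u0 \<beta> - psi0 \<phi> \<rho>0 u0 \<alpha>"
  assumes int: "locally_integrable \<phi>" and nonneg: "\<And>x. 0 \<le> \<phi> x" and rad: "radially_decreasing \<phi>"
    and s: "s < 1"
    and bound: "\<forall>x. 0 < \<bar>x\<bar> \<and> \<bar>x\<bar> < R0 \<longrightarrow> \<phi> x \<le> \<Lambda> * \<bar>x\<bar> powr (- s)"
    and \<rho>0: "integrable lebesgue \<rho>0" "\<And>x. 0 \<le> \<rho>0 x" and S: "open (initial_support \<rho>0)"
    and flow: "lagrangian_flow \<phi> \<rho>0 u0 X"
    and ab: "\<alpha> \<in> initial_support \<rho>0" "\<beta> \<in> initial_support \<rho>0" and t: "0 \<le> t"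
  shows "X \<beta> t \<le> X \<alpha> t \<Longrightarrow> \<psi> \<le> v \<beta> t - v \<alpha> t"
    and "0 < X \<beta> t - X \<alpha> t \<Longrightarrow> X \<beta> t - X \<alpha> t < 2 * R0 \<Longrightarrow>
      \<psi> - 2 powr s * \<Lambda> * total_mass \<rho>0 / (1 - s) * (X \<beta> t - X \<alpha> t) powr (1 - s) \<le> v \<beta> t - v \<alpha> t"
proof -
  have prim: "set_integrable (mass_measure \<rho>0) (initial_support \<rho>0) (\<lambda>\<gamma>. primitive \<phi> (X a t - X \<gamma> t))"
    if "a \<in> initial_support \<rho>0" for a
    using flow that t unfolding lagrangian_flow_def by blast
  note between = mass_integral_between[OF \<rho>0 S prim prim, OF ab]
  show "\<psi> \<le> v \<beta> t - v \<alpha> t" if "X \<beta> t \<le> X \<alpha> t"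
    using between[of 0] primitive_mono[OF int nonneg] that by (simp add: v_def \<psi>_def)
  assume d: "0 < X \<beta> t - X \<alpha> t" "X \<beta> t - X \<alpha> t < 2 * R0"
  let ?C = "2 powr s * \<Lambda> / (1 - s) * (X \<beta> t - X \<alpha> t) powr (1 - s)"
  have "primitive \<phi> (X \<beta> t - \<gamma>) - primitive \<phi> (X \<alpha> t - \<gamma>) \<le> ?C" for \<gamma>
    using primitive_increment_le[OF int rad s bound, of "X \<beta> t - \<gamma>" "X \<alpha> t - \<gamma>"] d by simp
  from between[of ?C, OF this]
  show "\<psi> - 2 powr s * \<Lambda> * total_mass \<rho>0 / (1 - s) * (X \<beta> t - X \<alpha> t) powr (1 - s) \<le> v \<beta> t - v \<alpha> t"
    by (simp add: v_def \<psi>_def mult_ac)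
qed

section \<open>Comparison of the distance of two particles with its threshold\<close>

theorem proposition5p1:
  fixes \<phi> \<rho>0 u0 :: "real \<Rightarrow> real" and X :: "real \<Rightarrow> real \<Rightarrow> real"
    and s \<Lambda> R0 \<alpha> \<beta> :: real
  assumes phi_nonneg: "\<And>x. 0 \<le> \<phi> x"
    and phi_rad: "radially_decreasing \<phi>"
    and phi_sing: "weakly_singular \<phi>"
    and s: "0 < s" "s < 1"
    and Lam: "0 < \<Lambda>"
    and R0: "0 < R0"
    and phi_bound: "\<And>x. 0 < \<bar>x\<bar> \<Longrightarrow> \<bar>x\<bar> < R0 \<Longrightarrow> \<phi> x \<le> \<Lambda> * \<bar>x\<bar> powr (- s)"
    and rho_nonneg: "\<And>x. 0 \<le> \<rho>0 x"
    and rho_int: "integrable lebesgue \<rho>0"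
    and supp: "bounded (initial_support \<rho>0)" "open (initial_support \<rho>0)"
    and flow: "lagrangian_flow \<phi> \<rho>0 u0 X"
    and ab: "\<alpha> \<in> initial_support \<rho>0" "\<beta> \<in> initial_support \<rho>0" "\<alpha> < \<beta>"
  shows "let Xba = (\<lambda>t. X \<beta> t - X \<alpha> t);
             psiba = psi0 \<phi> \<rho>0 u0 \<beta> - psi0 \<phi> \<rho>0 u0 \<alpha>;
             M0 = total_mass \<rho>0;
             c = ((1 - s) * psiba / (2 powr s * \<Lambda> * M0)) powr (1 / (1 - s))
         in (\<forall>t\<ge>0. 0 < Xba t \<and> Xba t < 2 * R0 \<longrightarrow>
               (\<exists>D. (Xba has_real_derivative D) (at t within {0..}) \<and>
                    D \<ge> psiba - 2 powr s * \<Lambda> * M0 / (1 - s) * Xba t powr (1 - s))) \<and>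
            (psiba \<ge> 0 \<longrightarrow>
               (INF t\<in>{0..}. ereal (Xba t)) \<ge> ereal (min (\<beta> - \<alpha>) (min c (2 * R0))) \<and>
               Liminf at_top (\<lambda>t. ereal (Xba t)) \<ge> ereal (min c (2 * R0)) \<and>
               (\<beta> - \<alpha> < min c (2 * R0) \<longrightarrow>
                  (\<forall>T\<ge>0. (\<forall>t\<in>{0..<T}. Xba t < min c (2 * R0)) \<longrightarrow>
                     strict_mono_on {0..T} Xba)))"
proof -
  define Xba where "Xba = (\<lambda>t. X \<beta> t - X \<alpha> t)"
  define \<psi> where "\<psi> = psi0 \<phi> \<rho>0 u0 \<beta> - psi0 \<phi> \<rho>0 u0 \<alpha>"
  define K where "K = 2 powr s * \<Lambda> * total_mass \<rho>0 / (1 - s)"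
  \<comment> \<open>For \<open>\<psi> \<ge> 0\<close> and \<open>K > 0\<close> this is the level at
    which the lower velocity bound \<open>\<psi> - K * x powr (1 - s)\<close> vanishes.\<close>
  define c where "c = ((1 - s) * \<psi> / (2 powr s * \<Lambda> * total_mass \<rho>0)) powr (1 / (1 - s))"
  define v where "v = (\<lambda>a t. psi0 \<phi> \<rho>0 u0 a
      - (LINT \<gamma>:initial_support \<rho>0|mass_measure \<rho>0. primitive \<phi> (X a t - X \<gamma> t)))"
  define D where "D = (\<lambda>t. v \<beta> t - v \<alpha> t)"
  let ?m = "min c (2 * R0)"
  have int: "locally_integrable \<phi>" using phi_sing by (simp add: weakly_singular_def)
  have deriv: "(Xba has_real_derivative D t) (at t within {0..})" if "0 \<le> t" for t
    using flow ab that unfolding lagrangian_flow_def Xba_def D_def v_def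
    by (intro DERIV_diff) blast+
  have X0: "Xba 0 = \<beta> - \<alpha>"
    using flow ab by (simp add: lagrangian_flow_def Xba_def)
  have bound: "\<forall>x. 0 < \<bar>x\<bar> \<and> \<bar>x\<bar> < R0 \<longrightarrow> \<phi> x \<le> \<Lambda> * \<bar>x\<bar> powr (- s)"
    using phi_bound by blast
  note vel = relative_velocity_ge[OF int phi_nonneg phi_rad s(2) bound rho_int rho_nonneg
      supp(2) flow ab(1,2), folded \<psi>_def K_def]
  have D_neg: "\<psi> \<le> D t" if "0 \<le> t" "Xba t \<le> 0" for t
    using vel(1)[of t] that by (simp add: Xba_def D_def v_def)
  have D_pos: "\<psi> - K * Xba t powr (1 - s) \<le> D t" if "0 \<le> t" "0 < Xba t" "Xba t < 2 * R0" for t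
    using vel(2)[of t] that by (simp add: Xba_def D_def v_def)

  have K: "0 \<le> K" using Lam s by (simp add: K_def total_mass_def)
  have c_eq: "c = (\<psi> / K) powr (1 / (1 - s))"
    using s by (simp add: c_def K_def mult_ac)
  have "0 \<le> c" by (simp add: c_def)
  have below_c: "K * x powr (1 - s) < \<psi>" if "0 \<le> \<psi>" "0 < x" "x < c" for x
  proof -
    \<comment> \<open>Division by 0 and powers of 0 give 0, so a positive \<open>c\<close> forces
      \<open>\<psi>\<close> and \<open>K\<close> to be nonzero. This supplies \<open>0 < K\<close>
      without an argument about the mass.\<close>
    from that have "\<psi> / K \<noteq> 0" unfolding c_eq by auto
    with K that have "0 < K" "0 < \<psi> / K" by (auto simp: less_le)
    have "x powr (1 - s) < c powr (1 - s)"
      using that s by (intro powr_less_mono2) auto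
    also have "c powr (1 - s) = \<psi> / K"
      using s \<open>0 < K\<close> \<open>0 \<le> \<psi>\<close> by (simp add: c_eq powr_powr)
    finally show ?thesis using \<open>0 < K\<close> by (simp add: field_simps)
  qed
  text \<open>The bound is uniform in \<open>t\<close> and positive for \<open>a < c\<close>, so the level \<open>a\<close> is crossed in finite
    time.\<close>
  have D_below: "\<psi> - K * a powr (1 - s) \<le> D t"
    if "0 \<le> t" "Xba t < a" "0 < a" "a < 2 * R0" for t a
  proof (cases "0 < Xba t")
    case True
    have "K * Xba t powr (1 - s) \<le> K * a powr (1 - s)"
      using True that s K by (intro mult_left_mono powr_mono2) auto
    with D_pos[OF that(1) True] that show ?thesis by simp
  next
    case False
    then have "\<psi> \<le> D t" using D_neg that(1) by simp
    moreover have "0 \<le> K * a powr (1 - s)" using K by simp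
    ultimately show ?thesis by linarith
  qed
  \<comment> \<open>Reversed order gives only the bound \<open>\<psi>\<close>, which may be 0. The
    disjunction yields \<open>0 \<le> D t\<close> for invariance and, once \<open>\<psi>\<close> is
    positive, the strict sign for monotonicity.\<close>
  have D_ge: "0 < D t \<or> \<psi> \<le> D t" if "0 \<le> \<psi>" "0 \<le> t" "Xba t < ?m" for t
  proof (cases "0 < Xba t")
    case True
    with that have "K * Xba t powr (1 - s) < \<psi>" by (intro below_c) auto
    moreover have "\<psi> - K * Xba t powr (1 - s) \<le> D t" using True that by (intro D_pos) auto
    ultimately show ?thesis by linarith
  next
    case False
    then show ?thesis using D_neg that by simp
  qed
  have ge: "a \<le> Xba t" if "0 \<le> \<psi>" "a \<le> ?m" "0 \<le> t0" "t0 \<le> t" "a \<le> Xba t0" for a t0 t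
  proof (rule superlevel_invariant[OF deriv _ that(3-5)])
    show "0 \<le> D t" if "0 \<le> t" "Xba t < a" for t
      using D_ge[of t] that \<open>0 \<le> \<psi>\<close> \<open>a \<le> ?m\<close> by auto
  qed

  have liminf: "ereal ?m \<le> Liminf at_top (\<lambda>t. ereal (Xba t))" if "0 \<le> \<psi>"
  proof (cases "c = 0")
    case True
    have "0 \<le> Xba t" if "0 \<le> t" for t
      using X0 ab(3) R0 \<open>0 \<le> c\<close> \<open>0 \<le> \<psi>\<close> that by (intro ge[of 0 0 t]) auto
    then have "eventually (\<lambda>t. 0 \<le> Xba t) at_top"
      by (rule eventually_at_top_linorderI)
    then show ?thesis
      using True R0 by (intro Liminf_bounded) simp
  next
    case False
    \<comment> \<open>The velocity bound vanishes at \<open>c\<close>, so \<open>?m\<close> need not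
      be reached in finite time. Each positive level \<open>a < ?m\<close> is, at rate at least
      \<open>\<psi> - K * a powr (1 - s) > 0\<close>, and such levels come arbitrarily close to
      \<open>?m\<close>.\<close>
    show ?thesis
    proof (rule dense_le)
      fix y assume "y < ereal ?m"
      moreover have "0 < ?m" using False \<open>0 \<le> c\<close> R0 by simp
      \<comment> \<open>The maximum with 0 makes the level \<open>a\<close> chosen above it
        positive, as \<open>below_c\<close> and \<open>D_below\<close> require.\<close>
      ultimately have "max y 0 < ereal ?m" by (simp add: zero_ereal_def)
      then obtain a where a: "max y 0 < ereal a" "ereal a < ereal ?m"
        using ereal_dense2 by blast
      then have "0 < a" "a < c" "a < 2 * R0" by auto
      have "eventually (\<lambda>t. a \<le> Xba t) at_top"
        using below_c[OF that \<open>0 < a\<close> \<open>a < c\<close>] D_below \<open>0 < a\<close> \<open>a < 2 * R0\<close>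
        by (intro eventually_ge_of_derivative_ge[OF deriv, of a "\<psi> - K * a powr (1 - s)"]) auto
      then have "ereal a \<le> Liminf at_top (\<lambda>t. ereal (Xba t))"
        by (intro Liminf_bounded) simp
      moreover have "y \<le> ereal a" using a(1) by (simp add: less_imp_le)
      ultimately show "y \<le> Liminf at_top (\<lambda>t. ereal (Xba t))" by (rule order.trans[rotated])
    qed
  qed
  have inf: "ereal (min (\<beta> - \<alpha>) ?m) \<le> (INF t\<in>{0..}. ereal (Xba t))" if "0 \<le> \<psi>"
  proof (rule INF_greatest)
    fix t :: real assume "t \<in> {0..}"
    then have "min (\<beta> - \<alpha>) ?m \<le> Xba t"
      using ge[OF that min.cobounded2, of 0 t "\<beta> - \<alpha>"] X0 by simp
    then show "ereal (min (\<beta> - \<alpha>) ?m) \<le> ereal (Xba t)" by (rule iffD2[OF ereal_less_eq(3)])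
  qed
  have mono: "strict_mono_on {0..T} Xba"
    if "0 \<le> \<psi>" "\<beta> - \<alpha> < ?m" "\<forall>t\<in>{0..<T}. Xba t < ?m" for T
  proof (rule strict_mono_on_of_derivative_pos[OF deriv])
    \<comment> \<open>With \<open>\<psi> = 0\<close> the threshold \<open>c\<close> would be 0,
      which cannot exceed the initial distance \<open>\<beta> - \<alpha> > 0\<close>.\<close>
    have "\<psi> \<noteq> 0" using that(2) ab(3) by (auto simp: c_def)
    then show "0 < D t" if "0 \<le> t" "t < T" for t
      using D_ge[of t] that \<open>0 \<le> \<psi>\<close> \<open>\<forall>t\<in>{0..<T}. Xba t < ?m\<close> by force
  qed
  show ?thesis
    unfolding Let_def Xba_def[symmetric] \<psi>_def[symmetric] c_def[symmetric] K_def[symmetric]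
  proof (intro conjI allI impI)
    show "\<exists>D. (Xba has_real_derivative D) (at t within {0..}) \<and> \<psi> - K * Xba t powr (1 - s) \<le> D"
      if "0 \<le> t" "0 < Xba t \<and> Xba t < 2 * R0" for t
      using deriv[of t] D_pos[of t] that by blast
  qed (rule inf liminf mono; assumption)+
qed

end
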